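(* If $a$ is a product (concatenation) of pyramids, then for every integer $k\ge 0$, $$ f(u^k a d^k) = \zeta^{k+1}\big(a,\, u^{|a|/2} d^{|a|/2}\big). $$
   Context: A (binary) path of length $n$ is a lattice path $P=p_1\cdots p_n$ starting at the origin, each step being an upstep $u=(1,1)$ or a downstep $d=(1,-1)$; $|P|=n$ is its length, $\mathcal{P}_n$ the set of paths of length $n$, $\mathcal{P}=\bigcup_{n\ge0}\mathcal{P}_n$, and $[k]=\{1,\dots,k\}$. $\mathcal{P}_n$ is ordered by $P\le Q$ iff $P$ lies weakly below $Q$ (at each abscissa the height, i.e. $y$-coordinate, of $P$ is at most that of $Q$); its maximum is $\mathbf{1}_n=u^n$. A valley of $P$ is the last point of a maximal run of $d$'s: it is either the middle point of an occurrence of $du$, or the endpoint of $P$ when $P$ ends with $d$. Turning a valley into a peak means replacing the corresponding $du$ by $ud$ (or, for a valley at the end of the path, the final $d$ by $u$). The filling of $P$ is the path $\widetilde P$ obtained by turning every valley of $P$ into a peak (so $\widetilde{\mathbf 1_n}=\mathbf 1_n$). Put $P^{(0)}=P$, $P^{(i)}=\widetilde{P^{(i-1)}}$; the degree $\delta(P)$ is the least $k\ge0$ with $P^{(k)}=\mathbf 1_{|P|}$. A chain $P_0\le P_1\le\cdots\le P_k$ (of length $k$) has small intervals if for each $i\in[k]$ the path $P_i$ is obtained from $P_{i-1}$ by turning some valleys of $P_{i-1}$ into peaks (equivalently $P_{i-1}\le P_i\le\widetilde{P_{i-1}}$). $f(P)$ is the number of chains of length $\delta(P)$ with small intervals from $P$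 to $\mathbf 1_{|P|}$. A pyramid is a path of the form $u^m d^m$, $m\ge0$. $\zeta$ is the zeta function of the poset $\mathcal{P}$ ($\zeta(x,y)=1$ if $x\le y$ and $0$ otherwise), and its powers are convolution powers in the incidence algebra, so that $\zeta^{k}(x,y)$ is the number of multichains $x=x_0\le x_1\le\cdots\le x_k=y$ of length $k$. *)

theory Defs
  imports Main
begin

datatype step = U | D

type_synonym path = "step list"

fun rise :: "step \<Rightarrow> int" where
  "rise U = 1"
| "rise D = - 1"

definition height :: "path \<Rightarrow> nat \<Rightarrow> int" where
  "height P i = (\<Sum>j<i. rise (P ! j))"

text \<open>Paths of different lengths are incomparable.\<close>

definition path_le :: "path \<Rightarrow> path \<Rightarrow> bool"  (infix "\<sqsubseteq>" 50) where
  "P \<sqsubseteq> Q \<longleftrightarrow> length P = length Q \<and> (\<forall>i\<le>length P. height P i \<le> height Q i)"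

definition top_path :: "nat \<Rightarrow> path" where
  "top_path n = replicate n U"

text \<open>Valleys are given by their abscissae. The point of abscissa \<open>i\<close> lies between the
  steps \<open>P ! (i - 1)\<close> and \<open>P ! i\<close>; a final point preceded by a downstep is a valley.\<close>

definition valleys :: "path \<Rightarrow> nat set" where
  "valleys P = {i. 0 < i \<and> i \<le> length P \<and> P ! (i - 1) = D \<and> (i < length P \<longrightarrow> P ! i = U)}"

text \<open>Turns all valleys in \<open>S \<subseteq> valleys P\<close> into peaks simultaneously. Step \<open>j\<close> goes from
  abscissa \<open>j\<close> to \<open>Suc j\<close>, and at most one of its two ends is a valley.\<close>

definition turn :: "path \<Rightarrow> nat set \<Rightarrow> path" where
  "turn P S = map (\<lambda>j. if Suc j \<in> S then U else if j \<in> S then D else P ! j) [0..<length P]"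

definition filling :: "path \<Rightarrow> path" where
  "filling P = turn P (valleys P)"

definition degree :: "path \<Rightarrow> nat" where
  "degree P = (LEAST k. (filling ^^ k) P = top_path (length P))"

definition small_interval :: "path \<Rightarrow> path \<Rightarrow> bool" where
  "small_interval P Q \<longleftrightarrow> (\<exists>S \<subseteq> valleys P. Q = turn P S)"

text \<open>A chain of length \<open>k\<close> is a list of \<open>k + 1\<close> paths, possibly with repetitions.\<close>

definition small_chains :: "nat \<Rightarrow> path \<Rightarrow> path \<Rightarrow> path list set" where
  "small_chains k P Q = {Ps. length Ps = k + 1 \<and> Ps ! 0 = P \<and> Ps ! k = Q \<and>
     (\<forall>i<k. Ps ! i \<sqsubseteq> Ps ! Suc i \<and> small_interval (Ps ! i) (Ps ! Suc i))}"

definition num_chains :: "path \<Rightarrow> nat" where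
  "num_chains P = card (small_chains (degree P) P (top_path (length P)))"

definition pyramid :: "path \<Rightarrow> bool" where
  "pyramid P \<longleftrightarrow> (\<exists>m. P = replicate m U @ replicate m D)"

definition product_of_pyramids :: "path \<Rightarrow> bool" where
  "product_of_pyramids a \<longleftrightarrow> (\<exists>Ps. (\<forall>P\<in>set Ps. pyramid P) \<and> a = concat Ps)"

text \<open>The incidence algebra of the poset of paths, with integer coefficients.\<close>

definition zeta :: "path \<Rightarrow> path \<Rightarrow> int" where
  "zeta x y = (if x \<sqsubseteq> y then 1 else 0)"

definition convolution ::
  "(path \<Rightarrow> path \<Rightarrow> int) \<Rightarrow> (path \<Rightarrow> path \<Rightarrow> int) \<Rightarrow> path \<Rightarrow> path \<Rightarrow> int" where
  "convolution F G x y = (\<Sum>z | x \<sqsubseteq> z \<and> z \<sqsubseteq> y. F x z * G z y)"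

fun conv_power :: "(path \<Rightarrow> path \<Rightarrow> int) \<Rightarrow> nat \<Rightarrow> path \<Rightarrow> path \<Rightarrow> int" where
  "conv_power F 0 = (\<lambda>x y. if x = y then 1 else 0)"
| "conv_power F (Suc n) = convolution F (conv_power F n)"

text \<open>The sets that are summed over and counted above are finite, and \<open>degree\<close> is attained.\<close>

lemma finite_step: "finite (UNIV :: step set)"
proof -
  have "s \<in> {U, D}" for s
    by (cases s) auto
  then have "(UNIV :: step set) \<subseteq> {U, D}"
    by blast
  then show ?thesis
    by (rule finite_subset) simp
qed

lemma finite_interval: "finite {z. x \<sqsubseteq> z \<and> z \<sqsubseteq> y}"
proof -
  have "finite {z :: path. set z \<subseteq> UNIV \<and> length z = length x}"
    using finite_step by (rule finite_lists_length_eq)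
  then show ?thesis
    by (rule rev_finite_subset) (auto simp: path_le_def)
qed

lemma length_filling [simp]: "length (filling P) = length P"
  by (simp add: filling_def turn_def)

lemma length_filling_power [simp]: "length ((filling ^^ k) P) = length P"
  by (induction k) auto

lemma finite_small_chains: "finite (small_chains k P Q)"
proof -
  let ?A = "{z :: path. set z \<subseteq> UNIV \<and> length z = length P}"
  have "finite ?A"
    using finite_step by (rule finite_lists_length_eq)
  then have "finite {Ps. set Ps \<subseteq> ?A \<and> length Ps = k + 1}"
    by (rule finite_lists_length_eq)
  moreover have "small_chains k P Q \<subseteq> {Ps. set Ps \<subseteq> ?A \<and> length Ps = k + 1}"
  proof
    fix Ps assume Ps: "Ps \<in> small_chains k P Q"
    have step: "length (Ps ! Suc i) = length (Ps ! i)" if "i < k" for i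
      using Ps that unfolding small_chains_def path_le_def by fastforce
    have "length (Ps ! i) = length P" if "i \<le> k" for i
      using that
    proof (induction i)
      case 0
      then show ?case
        using Ps by (simp add: small_chains_def)
    next
      case (Suc i)
      then show ?case
        using step[of i] by simp
    qed
    moreover have "length Ps = k + 1"
      using Ps by (simp add: small_chains_def)
    ultimately show "Ps \<in> {Ps. set Ps \<subseteq> ?A \<and> length Ps = k + 1}"
      by (auto simp: in_set_conv_nth)
  qed
  ultimately show ?thesis
    by (rule rev_finite_subset)
qed

lemma height_turn:
  assumes "S \<subseteq> valleys P" "i \<le> length P"
  shows "height (turn P S) i = height P i + (if i \<in> S then 2 else 0)"
  using assms(2)
proof (induction i)
  case 0
  have "0 \<notin> S"
    using assms(1) by (auto simp: valleys_def)
  then show ?case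
    by (simp add: height_def)
next
  case (Suc i)
  have *: "P ! i = D" if "Suc i \<in> S"
  proof -
    have "Suc i \<in> valleys P"
      using assms(1) that by blast
    then show ?thesis
      by (simp add: valleys_def)
  qed
  have **: "P ! i = U" if "i \<in> S"
  proof -
    have "i \<in> valleys P"
      using assms(1) that by blast
    then show ?thesis
      using Suc.prems by (simp add: valleys_def)
  qed
  have "turn P S ! i = (if Suc i \<in> S then U else if i \<in> S then D else P ! i)"
    using Suc.prems by (simp add: turn_def)
  then show ?case
    using Suc * ** by (auto simp: height_def split: if_splits)
qed

lemma height_le: "height P i \<le> int i"
proof -
  have "rise s \<le> 1" for s by (cases s) auto
  then have "height P i \<le> (\<Sum>j<i. 1)"
    unfolding height_def by (intro sum_mono)
  then show ?thesis by simp
qed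

lemma valleys_top: "valleys (top_path n) = {}"
  by (auto simp: valleys_def top_path_def)

lemma valleys_empty_iff: "valleys P = {} \<longleftrightarrow> P = top_path (length P)"
proof
  assume *: "valleys P = {}"
  have "P ! i = U" if "i < length P" for i
    using that
  proof (induction "length P - i" arbitrary: i rule: less_induct)
    case less
    have "P ! Suc i = U" if "Suc i < length P"
      using less.hyps[of "Suc i"] less.prems that by simp
    moreover have "Suc i \<notin> valleys P"
      using * by simp
    ultimately show ?case
      using less.prems by (cases "P ! i") (auto simp: valleys_def)
  qed
  then show "P = top_path (length P)"
    unfolding top_path_def by (intro nth_equalityI) auto
next
  assume *: "P = top_path (length P)"
  show "valleys P = {}"
    by (subst *) (rule valleys_top)
qed

lemma filling_reaches_top: "\<exists>k. (filling ^^ k) P = top_path (length P)"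
proof (induction "nat (\<Sum>i\<le>length P. int i - height P i)" arbitrary: P rule: less_induct)
  case less
  show ?case
  proof (cases "valleys P = {}")
    case True
    then have "(filling ^^ 0) P = top_path (length P)"
      by (simp flip: valleys_empty_iff)
    then show ?thesis by blast
  next
    case False
    then obtain v where v: "v \<in> valleys P" by blast
    have h: "height (filling P) i = height P i + (if i \<in> valleys P then 2 else 0)"
      if "i \<le> length P" for i
      using height_turn[OF subset_refl that] by (simp add: filling_def)
    have "(\<Sum>i\<le>length P. int i - height (filling P) i) < (\<Sum>i\<le>length P. int i - height P i)"
      by (rule sum_strict_mono_ex1) (use v h in \<open>auto simp: valleys_def intro!: bexI[of _ v]\<close>)
    moreover have "0 \<le> (\<Sum>i\<le>length P. int i - height (filling P) i)"
      using height_le by (intro sum_nonneg) simp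
    ultimately have "nat (\<Sum>i\<le>length (filling P). int i - height (filling P) i)
        < nat (\<Sum>i\<le>length P. int i - height P i)"
      by simp
    from less[OF this] obtain k where "(filling ^^ k) (filling P) = top_path (length P)"
      by auto
    then have "(filling ^^ Suc k) P = top_path (length P)"
      by (simp add: funpow_swap1)
    then show ?thesis by blast
  qed
qed

lemma filling_degree: "(filling ^^ degree P) P = top_path (length P)"
  unfolding degree_def by (rule LeastI_ex) (rule filling_reaches_top)

end

theory Submission
  imports Defs
begin

text \<open>
  Describe a path \<open>p\<close> by the cells \<open>(i, h)\<close> lying below it, where \<open>h\<close> has the parity of \<open>i\<close> and
  \<open>h < height p i\<close>. A chain with small intervals, made constant outside its index range, becomes
  a set of triples \<open>(t, i, h)\<close> that is closed under \<open>(t, i, h) \<mapsto> (t + 1, i, h)\<close> (the chain rises) and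
  \<open>(t, i, h) \<mapsto> (t - 1, i \<plusminus> 1, h - 1)\<close> (only valleys are turned). The involution
  \<open>(t, i, h) \<mapsto> (h + 1 - t, i, h)\<close> changes these two conditions into
  \<open>(j, i, h) \<mapsto> (j - 1, i, h)\<close> and \<open>(j, i, h) \<mapsto> (j, i \<plusminus> 1, h - 1)\<close>, which describe a weakly
  falling family of arbitrary paths, that is, a multichain.

  Let \<open>P = u^k a d^k\<close> have length \<open>n > 0\<close>; its degree is \<open>n - 1\<close>. Under the involution, the boundary
  conditions of a chain of length \<open>n - 1\<close> from \<open>P\<close> to the top path say that the \<open>j\<close>-th path is the top
  path for \<open>j \<le> 0\<close>, lies between \<open>P\<close> and the pyramid of length \<open>n\<close> for \<open>1 \<le> j \<le> k\<close>, and is \<open>P\<close> for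
  \<open>j > k\<close>; the last point uses that all valleys of \<open>a\<close> have height 0. Removing the initial \<open>u^k\<close> and
  the final \<open>d^k\<close> leaves the multichains of length \<open>k + 1\<close> from \<open>a\<close> to the pyramid of length \<open>|a|\<close>.
\<close>

section \<open>Paths as sets of cells\<close>

text \<open>The columns are unbounded below, so none is empty; by parity the topmost cell of column
  \<open>i\<close> is \<open>(i, height p i - 2)\<close>. This cell is the test cell in several
  comparisons below.\<close>

definition cells :: "path \<Rightarrow> (nat \<times> int) set" where
  "cells p = {(i, h). i \<le> length p \<and> even (h - int i) \<and> h < height p i}"

text \<open>For \<open>A = B\<close> this is the slope condition on the cells of one path. For the
  cells of two paths with \<open>p \<sqsubseteq> q\<close> it expresses that only valleys are
  turned.\<close>

definition supports :: "nat \<Rightarrow> (nat \<times> int) set \<Rightarrow> (nat \<times> int) set \<Rightarrow> bool" where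
  "supports n A B \<longleftrightarrow>
    (\<forall>i h i'. (i, h) \<in> B \<longrightarrow> i' \<le> n \<longrightarrow> i' = Suc i \<or> i = Suc i' \<longrightarrow> (i', h - 1) \<in> A)"

lemma height_0 [simp]: "height p 0 = 0"
  by (simp add: height_def)

lemma height_Suc: "height p (Suc i) = height p i + rise (p ! i)"
  by (simp add: height_def)

lemma rise_cases: "rise s = 1 \<or> rise s = - 1"
  by (cases s) auto

lemma even_height: "even (height p i - int i)"
proof (induction i)
  case (Suc i)
  then show ?case
    using rise_cases[of "p ! i"] by (auto simp: height_Suc)
qed simp

lemma height_cong_parity: "even (height p i - height q i)"
  using even_height[of p i] even_height[of q i] by presburger

lemma height_lipschitz: "height p (i + d) \<le> height p i + int d" "height p i \<le> height p (i + d) + int d"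
proof -
  have "\<bar>height p (i + d) - height p i\<bar> \<le> int d"
  proof (induction d)
    case (Suc d)
    then show ?case
      using rise_cases[of "p ! (i + d)"] by (auto simp: height_Suc)
  qed simp
  then show "height p (i + d) \<le> height p i + int d" "height p i \<le> height p (i + d) + int d"
    by auto
qed

lemma height_le_height_add_dist: "height p i \<le> height p j + \<bar>int i - int j\<bar>"
proof (cases "i \<le> j")
  case True
  then show ?thesis using height_lipschitz(2)[of p i "j - i"] by (simp add: of_nat_diff)
next
  case False
  then show ?thesis using height_lipschitz(1)[of p j "i - j"] by (simp add: of_nat_diff)
qed

lemma path_eqI:
  assumes "length p = length q" "\<And>i. i \<le> length p \<Longrightarrow> height p i = height q i"
  shows "p = q"
proof (rule nth_equalityI)
  fix i assume "i < length p"
  then have "rise (p ! i) = rise (q ! i)"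
    using assms(2)[of i] assms(2)[of "Suc i"] by (simp add: height_Suc)
  then show "p ! i = q ! i"
    by (cases "p ! i"; cases "q ! i") auto
qed (rule assms(1))

lemma path_le_refl [simp]: "p \<sqsubseteq> p"
  by (simp add: path_le_def)

lemma path_le_trans: "p \<sqsubseteq> q \<Longrightarrow> q \<sqsubseteq> r \<Longrightarrow> p \<sqsubseteq> r"
  unfolding path_le_def by force

lemma path_le_antisym: "p \<sqsubseteq> q \<Longrightarrow> q \<sqsubseteq> p \<Longrightarrow> p = q"
  by (rule path_eqI) (auto simp: path_le_def order_antisym)

lemma length_path_le: "p \<sqsubseteq> q \<Longrightarrow> length q = length p"
  by (simp add: path_le_def)

text \<open>For the converse, the topmost cell of each column of \<open>p\<close> suffices: it gives
  \<open>height p i - 2 < height q i\<close>, and equal parity excludes a shortfall of one.\<close>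

lemma path_le_iff_cells:
  assumes "length p = length q"
  shows "p \<sqsubseteq> q \<longleftrightarrow> cells p \<subseteq> cells q"
proof
  show "p \<sqsubseteq> q \<Longrightarrow> cells p \<subseteq> cells q"
    unfolding path_le_def cells_def by force
next
  assume sub: "cells p \<subseteq> cells q"
  show "p \<sqsubseteq> q"
    unfolding path_le_def
  proof (intro conjI allI impI)
    fix i assume "i \<le> length p"
    then have "(i, height p i - 2) \<in> cells p"
      using even_height[of p i] by (auto simp: cells_def)
    then have "(i, height p i - 2) \<in> cells q"
      using sub by blast
    then have "height p i - 2 < height q i"
      by (simp add: cells_def)
    then show "height p i \<le> height q i"
      using height_cong_parity[of p i q] by presburger
  qed (rule assms)
qed

lemma cells_inject:
  assumes "length p = length q" "cells p = cells q"
  shows "p = q"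
  using assms by (intro path_le_antisym) (simp_all add: path_le_iff_cells)

lemma mem_cells_iff:
  assumes "length p = n" "i \<le> n" "even (h - int i)"
  shows "(i, h) \<in> cells p \<longleftrightarrow> h < height p i"
  using assms by (simp add: cells_def)

lemma supports_cells: "length p = n \<Longrightarrow> supports n (cells p) (cells p)"
  unfolding supports_def
proof (intro allI impI)
  fix i h i' assume *: "length p = n" "(i, h) \<in> cells p" "i' \<le> n" "i' = Suc i \<or> i = Suc i'"
  then show "(i', h - 1) \<in> cells p"
    using height_le_height_add_dist[of p i i'] by (auto simp: cells_def)
qed

lemma supports_mono: "supports n A B \<Longrightarrow> A \<subseteq> A' \<Longrightarrow> B' \<subseteq> B \<Longrightarrow> supports n A' B'"
  unfolding supports_def by blast

lemma supportsD: "supports n A B \<Longrightarrow> (i, h) \<in> B \<Longrightarrow> i' \<le> n \<Longrightarrow> i' = Suc i \<or> i = Suc i' \<Longrightarrow> (i', h - 1) \<in> A"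
  unfolding supports_def by blast

text \<open>Column 0 fixes the starting point, and the support condition forces each column to be
  the previous one shifted up or down by one; these shifts are the steps of the path.\<close>

lemma ex1_path_cells:
  assumes grid: "\<And>i h. (i, h) \<in> S \<Longrightarrow> i \<le> n \<and> even (h - int i)"
    and zero: "\<And>h. (0, h) \<in> S \<longleftrightarrow> even h \<and> h < 0"
    and supp: "supports n S S"
  shows "\<exists>!p. length p = n \<and> cells p = S"
proof -
  define p where
    "p = map (\<lambda>i. if \<forall>h. (i, h) \<in> S \<longrightarrow> (Suc i, h + 1) \<in> S then U else D) [0..<n]"
  have len: "length p = n"
    by (simp add: p_def)
  have *: "(i, h) \<in> S \<longleftrightarrow> even (h - int i) \<and> h < height p i" if "i \<le> n" for i h
    using that
  proof (induction i arbitrary: h)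
    case 0
    then show ?case by (simp add: zero)
  next
    case (Suc i)
    have IH: "(i, h) \<in> S \<longleftrightarrow> even (h - int i) \<and> h < height p i" for h
      using Suc by simp
    have up: "(i, h - 1) \<in> S" if "(Suc i, h) \<in> S" for h
      using supportsD[OF supp that, of i] Suc.prems by simp
    have down: "(Suc i, h - 1) \<in> S" if "(i, h) \<in> S" for h
      using supportsD[OF supp that, of "Suc i"] Suc.prems by simp
    show ?case
    proof (cases "\<forall>h. (i, h) \<in> S \<longrightarrow> (Suc i, h + 1) \<in> S")
      case True
      then have "p ! i = U" using Suc.prems by (simp add: p_def)
      moreover have "(Suc i, h) \<in> S \<longleftrightarrow> (i, h - 1) \<in> S"
        using up[of h] True[rule_format, of "h - 1"] by auto
      ultimately show ?thesis
        using IH[of "h - 1"] by (auto simp: height_Suc)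
    next
      case False
      then obtain g where g: "(i, g) \<in> S" "(Suc i, g + 1) \<notin> S" by blast
      have "p ! i = D" using Suc.prems False by (auto simp: p_def)
      then have H: "height p (Suc i) = height p i - 1" by (simp add: height_Suc)
      have ghi: "even (g - int i)" "g < height p i" using IH[of g] g by auto
      \<comment> \<open>The cell \<open>g\<close> that blocks an upstep must be the topmost one of
        its column: a cell \<open>(i, g + 2)\<close> would support the missing
        \<open>(Suc i, g + 1)\<close>.\<close>
      have top: "height p i \<le> g + 2"
      proof (rule ccontr)
        assume "\<not> height p i \<le> g + 2"
        then have "(i, g + 2) \<in> S" using IH[of "g + 2"] ghi by simp
        from down[OF this] g(2) show False by (simp add: add.commute)
      qed
      have "(Suc i, h) \<in> S \<longleftrightarrow> (i, h + 1) \<in> S"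
      proof
        assume hS: "(Suc i, h) \<in> S"
        have "even (h - 1 - int i)" "h - 1 < height p i"
          using up[OF hS] IH[of "h - 1"] by auto
        moreover have "h \<noteq> g + 1" using hS g by auto
        ultimately have "even (h + 1 - int i)" "h + 1 < height p i"
          using top ghi even_height[of p i] by presburger+
        then show "(i, h + 1) \<in> S" using IH by blast
      next
        assume "(i, h + 1) \<in> S"
        from down[OF this] show "(Suc i, h) \<in> S" by simp
      qed
      then show ?thesis
        using IH[of "h + 1"] H by auto
    qed
  qed
  have "cells p = S"
    using * grid by (auto simp: cells_def len)
  then show ?thesis
    using len cells_inject by blast
qed

text \<open>The cell \<open>(i, height p i)\<close> lies below \<open>q\<close>, so every neighbour
  of \<open>i\<close> is higher than \<open>i\<close> in \<open>p\<close>, which makes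
  \<open>i\<close> a valley. A gain of more than 2 would put a cell at level
  \<open>height p j\<close> of the left neighbour \<open>j\<close> below \<open>p\<close>.\<close>

lemma supports_height_less:
  assumes len: "length p = length q" and supp: "supports (length p) (cells p) (cells q)"
    and i: "i \<le> length p" and less: "height p i < height q i"
  shows "i \<in> valleys p \<and> height q i = height p i + 2"
proof -
  have "i \<noteq> 0" using less by (auto intro: ccontr)
  then obtain j where j: "i = Suc j" by (cases i) auto
  have "(i, height p i) \<in> cells q"
    using i len less even_height by (simp add: cells_def)
  note nb = supportsD[OF supp this]
  have "height p i - 1 < height p j"
    using nb[of j] i j by (simp add: cells_def)
  then have D: "p ! j = D"
    using j by (cases "p ! j") (auto simp: height_Suc)
  then have hj: "height p j = height p i + 1"
    using j by (simp add: height_Suc)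
  have "p ! i = U" if "i < length p"
  proof -
    have "height p i - 1 < height p (Suc i)"
      using nb[of "Suc i"] that by (simp add: cells_def)
    then show ?thesis
      by (cases "p ! i") (auto simp: height_Suc)
  qed
  then have v: "i \<in> valleys p"
    using i j D by (simp add: valleys_def)
  have "\<not> height p i + 2 < height q i"
  proof
    assume "height p i + 2 < height q i"
    then have "(i, height p i + 2) \<in> cells q"
      using i len even_height[of p i] by (simp add: cells_def)
    from supportsD[OF supp this, of j] show False
      using i j hj by (simp add: cells_def)
  qed
  then have "height q i = height p i + 2"
    using less height_cong_parity[of q i p] by presburger
  with v show ?thesis ..
qed

lemma small_interval_iff_supports:
  assumes le: "p \<sqsubseteq> q"
  shows "small_interval p q \<longleftrightarrow> supports (length p) (cells p) (cells q)"
proof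
  assume "small_interval p q"
  then obtain S where S: "S \<subseteq> valleys p" "q = turn p S"
    unfolding small_interval_def by blast
  have len: "length q = length p"
    using le by (rule length_path_le)
  show "supports (length p) (cells p) (cells q)"
    unfolding supports_def
  proof (intro allI impI)
    fix i h i'
    assume *: "(i, h) \<in> cells q" "i' \<le> length p" "i' = Suc i \<or> i = Suc i'"
    have i: "i \<le> length p" "even (h - int i)" "h < height p i + (if i \<in> S then 2 else 0)"
      using *(1) len height_turn[OF S(1)] S(2) by (auto simp: cells_def)
    \<comment> \<open>Every neighbour of a valley lies one above it, which absorbs the gain of 2 at
      \<open>i\<close>.\<close>
    have "height p i' = height p i + 1" if "i \<in> S"
      using * S(1) that by (fastforce simp: valleys_def height_Suc)
    then have "h - 1 < height p i'"
      using i(2,3) height_le_height_add_dist[of p i i'] *(3) even_height[of p i]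
      by (cases "i \<in> S") auto
    then show "(i', h - 1) \<in> cells p"
      using i *(2,3) by (auto simp: cells_def)
  qed
next
  assume supp: "supports (length p) (cells p) (cells q)"
  have len: "length p = length q"
    using le by (simp add: path_le_def)
  let ?S = "{i. i \<le> length p \<and> height p i < height q i}"
  have S: "?S \<subseteq> valleys p"
    using supports_height_less[OF len supp] by blast
  have "q = turn p ?S"
  proof (rule path_eqI)
    fix i assume "i \<le> length q"
    then have i: "i \<le> length p" using len by simp
    have "height p i \<le> height q i" using le i by (simp add: path_le_def)
    then show "height q i = height (turn p ?S) i"
      using height_turn[OF S i] supports_height_less[OF len supp i] i by auto
  qed (simp add: turn_def len)
  then show "small_interval p q"
    unfolding small_interval_def using S by blast
qed

section \<open>Filling as the largest supported path\<close>

lemma height_filling: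
  "i \<le> length p \<Longrightarrow> height (filling p) i = height p i + (if i \<in> valleys p then 2 else 0)"
  unfolding filling_def by (rule height_turn) auto

lemma path_le_filling: "p \<sqsubseteq> filling p"
  by (simp add: path_le_def height_filling)

lemma supports_filling: "supports (length p) (cells p) (cells (filling p))"
  using path_le_filling[of p] small_interval_iff_supports[of p "filling p"]
  by (auto simp: small_interval_def filling_def)

text \<open>Heights can grow only at valleys and by at most 2, and the filling attains this
  everywhere. With \<open>supports_filling\<close>, it is the largest path whose cells are supported
  by those of \<open>p\<close>.\<close>

lemma supports_imp_le_filling:
  assumes len: "length p = length q" and supp: "supports (length p) (cells p) (cells q)"
  shows "q \<sqsubseteq> filling p"
  unfolding path_le_def
proof (intro conjI allI impI)
  fix i assume "i \<le> length q"
  then have i: "i \<le> length p" using len by simp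
  show "height q i \<le> height (filling p) i"
    using supports_height_less[OF len supp i] i by (cases "height p i < height q i") (auto simp: height_filling)
qed (simp add: len)

section \<open>Multichains and powers of zeta\<close>

definition list_chains :: "('a \<Rightarrow> 'a \<Rightarrow> bool) \<Rightarrow> nat \<Rightarrow> 'a \<Rightarrow> 'a \<Rightarrow> 'a list set" where
  "list_chains R k x y = {xs. length xs = k + 1 \<and> xs ! 0 = x \<and> xs ! k = y \<and>
     (\<forall>i<k. R (xs ! i) (xs ! Suc i))}"

text \<open>Chains extended to all integer indices by constancy, so that the index can be sheared without
  regard to its range.\<close>

definition int_chains :: "('a \<Rightarrow> 'a \<Rightarrow> bool) \<Rightarrow> nat \<Rightarrow> 'a \<Rightarrow> 'a \<Rightarrow> (int \<Rightarrow> 'a) set" where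
  "int_chains R k x y = {F. (\<forall>t\<le>0. F t = x) \<and> (\<forall>t\<ge>int k. F t = y) \<and> (\<forall>t. R (F t) (F (t + 1)))}"

lemma card_int_chains:
  assumes refl: "\<And>x. R x x"
  shows "card (int_chains R k x y) = card (list_chains R k x y)"
proof (rule bij_betw_same_card, rule bij_betw_byWitness)
  let ?f = "\<lambda>F. map (\<lambda>i. F (int i)) [0..<k + 1]"
  \<comment> \<open>The index is clamped to the range from 0 to \<open>k\<close>, since
    \<open>nat\<close> sends negative integers to 0. Reflexivity of \<open>R\<close> covers the
    constant ends.\<close>
  let ?g = "\<lambda>xs t. xs ! min k (nat t)"
  show "\<forall>F\<in>int_chains R k x y. ?g (?f F) = F"
  proof
    fix F assume F: "F \<in> int_chains R k x y"
    show "?g (?f F) = F"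
    proof
      fix t
      have "?g (?f F) t = F (int (min k (nat t)))"
        by (subst nth_map) (simp_all add: nth_upt del: upt_Suc)
      also have "\<dots> = F t"
        using F by (cases "t \<le> 0"; cases "t \<ge> int k") (auto simp: int_chains_def min_def)
      finally show "?g (?f F) t = F t" .
    qed
  qed
  show "\<forall>xs\<in>list_chains R k x y. ?f (?g xs) = xs"
    by (auto simp: list_chains_def intro!: nth_equalityI simp del: upt_Suc)
  show "?f ` int_chains R k x y \<subseteq> list_chains R k x y"
    by (auto simp: list_chains_def int_chains_def add.commute simp del: upt_Suc)
  show "?g ` list_chains R k x y \<subseteq> int_chains R k x y"
  proof clarify
    fix xs assume xs: "xs \<in> list_chains R k x y"
    have "R (xs ! min k (nat t)) (xs ! min k (nat (t + 1)))" for t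
    proof (cases "0 \<le> t \<and> t < int k")
      case True
      then have "min k (nat t) = nat t" "min k (nat (t + 1)) = Suc (nat t)" "nat t < k"
        by auto
      then show ?thesis using xs by (simp add: list_chains_def)
    next
      case False
      then have "min k (nat t) = min k (nat (t + 1))" by auto
      then show ?thesis using refl by simp
    qed
    then show "?g xs \<in> int_chains R k x y"
      using xs by (auto simp: list_chains_def int_chains_def min_def)
  qed
qed

lemma list_chains_0: "list_chains R 0 x y = (if x = y then {[x]} else {})"
  by (auto simp: list_chains_def length_Suc_conv)

lemma list_chains_Suc: "list_chains R (Suc k) x y = (\<Union>z\<in>{z. R x z}. (#) x ` list_chains R k z y)"
proof (intro set_eqI iffI)
  fix xs assume xs: "xs \<in> list_chains R (Suc k) x y"
  then obtain ys where ys: "xs = x # ys"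
    by (cases xs) (auto simp: list_chains_def)
  have "R (xs ! Suc i) (xs ! Suc (Suc i))" if "i < k" for i
    using xs that by (simp add: list_chains_def)
  moreover have "R x (xs ! Suc 0)"
    using xs by (auto simp: list_chains_def)
  ultimately show "xs \<in> (\<Union>z\<in>{z. R x z}. (#) x ` list_chains R k z y)"
    using xs unfolding ys by (auto simp: list_chains_def)
next
  fix xs assume "xs \<in> (\<Union>z\<in>{z. R x z}. (#) x ` list_chains R k z y)"
  then obtain z ys where "xs = x # ys" "R x z" "ys \<in> list_chains R k z y" by blast
  then show "xs \<in> list_chains R (Suc k) x y"
    by (auto simp: list_chains_def nth_Cons split: nat.split)
qed

text \<open>This allows the second element of a chain to be restricted to the finite interval over
  which \<open>convolution\<close> sums.\<close>

lemma list_chains_imp_le: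
  "xs \<in> list_chains (\<sqsubseteq>) k x y \<Longrightarrow> x \<sqsubseteq> y"
proof (induction k arbitrary: x xs)
  case 0
  then show ?case by (auto simp: list_chains_0 split: if_splits)
next
  case (Suc k)
  then show ?case by (auto simp: list_chains_Suc intro: path_le_trans)
qed

lemma finite_list_chains: "finite (list_chains (\<sqsubseteq>) k x y)"
proof (induction k arbitrary: x)
  case 0
  then show ?case by (simp add: list_chains_0)
next
  case (Suc k)
  have "list_chains (\<sqsubseteq>) (Suc k) x y = (\<Union>z\<in>{z. x \<sqsubseteq> z \<and> z \<sqsubseteq> y}. (#) x ` list_chains (\<sqsubseteq>) k z y)"
    unfolding list_chains_Suc using list_chains_imp_le by blast
  then show ?case using Suc finite_interval by simp
qed

text \<open>Splitting off the first element of a chain corresponds to the left factor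
  \<open>zeta\<close>. The pieces are disjoint because the second element \<open>z\<close> can be
  read off from the chain.\<close>

lemma conv_power_zeta: "conv_power zeta k x y = int (card (list_chains (\<sqsubseteq>) k x y))"
proof (induction k arbitrary: x)
  case 0
  then show ?case by (simp add: list_chains_0)
next
  case (Suc k)
  have "list_chains (\<sqsubseteq>) (Suc k) x y = (\<Union>z\<in>{z. x \<sqsubseteq> z \<and> z \<sqsubseteq> y}. (#) x ` list_chains (\<sqsubseteq>) k z y)"
    unfolding list_chains_Suc using list_chains_imp_le by blast
  also have "card \<dots> = (\<Sum>z | x \<sqsubseteq> z \<and> z \<sqsubseteq> y. card ((#) x ` list_chains (\<sqsubseteq>) k z y))"
    by (intro card_UN_disjoint finite_interval ballI impI finite_imageI finite_list_chains)
      (auto simp: list_chains_def)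
  also have "\<dots> = (\<Sum>z | x \<sqsubseteq> z \<and> z \<sqsubseteq> y. card (list_chains (\<sqsubseteq>) k z y))"
    by (simp add: card_image)
  finally show ?case
    using Suc by (simp add: convolution_def zeta_def)
qed

section \<open>The shearing involution\<close>

text \<open>At a fixed cell the time \<open>t\<close> is replaced by \<open>h + 1 - t\<close>, which
  is self-inverse. On \<open>supported_families n\<close> the described path exists and is unique by
  \<open>ex1_path_cells\<close>.\<close>

definition shear :: "nat \<Rightarrow> (int \<Rightarrow> path) \<Rightarrow> int \<Rightarrow> path" where
  "shear n F j = (THE p. length p = n \<and> cells p = {(i, h). (i, h) \<in> cells (F (h + 1 - j))})"

text \<open>The common domain of the involution: both the small chains and the falling families of paths
  belong to it.\<close>

definition supported_families :: "nat \<Rightarrow> (int \<Rightarrow> path) set" where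
  "supported_families n =
    {F. \<forall>t. length (F t) = n \<and> supports n (cells (F (t - 1))) (cells (F t))}"

text \<open>Going to a neighbouring cell lowers \<open>h\<close>, and hence the time
  \<open>h + 1 - j\<close>, by one. The condition on \<open>F\<close> across consecutive times thus
  becomes the slope condition of a single path.\<close>

lemma
  assumes F: "F \<in> supported_families n"
  shows length_shear: "length (shear n F j) = n"
    and mem_cells_shear: "(i, h) \<in> cells (shear n F j) \<longleftrightarrow> (i, h) \<in> cells (F (h + 1 - j))"
proof -
  let ?S = "{(i, h). (i, h) \<in> cells (F (h + 1 - j))}"
  have len: "length (F t) = n" and supp: "supports n (cells (F (t - 1))) (cells (F t))" for t
    using F by (auto simp: supported_families_def)
  have "supports n ?S ?S"
    unfolding supports_def
  proof (intro allI impI)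
    fix i h i' assume "(i, h) \<in> ?S" and *: "i' \<le> n" "i' = Suc i \<or> i = Suc i'"
    then have "(i, h) \<in> cells (F (h + 1 - j))" by simp
    from supportsD[OF supp this *] show "(i', h - 1) \<in> ?S" by (simp add: algebra_simps)
  qed
  then have "\<exists>!p. length p = n \<and> cells p = ?S"
    by (intro ex1_path_cells) (auto simp: cells_def len)
  from theI'[OF this] have *: "length (shear n F j) = n \<and> cells (shear n F j) = ?S"
    unfolding shear_def .
  show "length (shear n F j) = n" using * by simp
  show "(i, h) \<in> cells (shear n F j) \<longleftrightarrow> (i, h) \<in> cells (F (h + 1 - j))" using * by simp
qed

text \<open>Lowering both \<open>h\<close> and \<open>t\<close> by one leaves the time
  \<open>h + 1 - t\<close> unchanged, so only the slope condition inside a single path of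
  \<open>F\<close> is required.\<close>

lemma shear_supported:
  assumes F: "F \<in> supported_families n"
  shows "shear n F \<in> supported_families n"
proof -
  have "(i', h - 1) \<in> cells (F (h - (t - 1)))"
    if *: "(i, h) \<in> cells (F (h + 1 - t))" "i' \<le> n" "i' = Suc i \<or> i = Suc i'"
    for t i h i'
  proof -
    have "length (F (h + 1 - t)) = n"
      using F by (simp add: supported_families_def)
    from supportsD[OF supports_cells[OF this] *] show ?thesis
      by (simp add: algebra_simps)
  qed
  then show ?thesis
    by (auto simp: supported_families_def supports_def length_shear[OF F] mem_cells_shear[OF F])
qed

lemma shear_shear:
  assumes F: "F \<in> supported_families n"
  shows "shear n (shear n F) = F"
proof
  fix t
  have "cells (shear n (shear n F) t) = cells (F t)"
    by (auto simp: mem_cells_shear[OF shear_supported[OF F]] mem_cells_shear[OF F])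
  moreover have "length (F t) = n"
    using F by (simp add: supported_families_def)
  ultimately show "shear n (shear n F) t = F t"
    by (intro cells_inject) (simp_all add: length_shear[OF shear_supported[OF F]])
qed

text \<open>As \<open>h + 1 - j\<close> decreases with \<open>j\<close>, this turns rising families
  into falling ones and conversely.\<close>

lemma shear_le_shear:
  assumes F: "F \<in> supported_families n" and le: "\<And>h. F (h + 1 - j) \<sqsubseteq> F (h + 1 - j')"
  shows "shear n F j \<sqsubseteq> shear n F j'"
proof -
  have "(i, h) \<in> cells (shear n F j')" if "(i, h) \<in> cells (shear n F j)" for i h
  proof -
    have "cells (F (h + 1 - j)) \<subseteq> cells (F (h + 1 - j'))"
      using F le[of h] by (simp add: path_le_iff_cells supported_families_def)
    with that show ?thesis
      by (auto simp: mem_cells_shear[OF F])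
  qed
  then show ?thesis
    by (auto simp: path_le_iff_cells length_shear[OF F])
qed

section \<open>Framed paths and products of pyramids\<close>

lemma height_append_le: "i \<le> length p \<Longrightarrow> height (p @ q) i = height p i"
  unfolding height_def by (intro sum.cong) (auto simp: nth_append)

lemma height_append_ge: "height (p @ q) (length p + i) = height p (length p) + height q i"
proof (induction i)
  case 0
  then show ?case by (simp add: height_append_le)
next
  case (Suc i)
  then show ?case by (simp add: height_Suc nth_append)
qed

lemma height_replicate_U: "i \<le> k \<Longrightarrow> height (replicate k U) i = int i"
  by (simp add: height_def)

lemma height_replicate_D: "i \<le> k \<Longrightarrow> height (replicate k D) i = - int i"
  by (simp add: height_def)

definition peak :: "nat \<Rightarrow> path" where
  "peak m = replicate m U @ replicate m D"

lemma length_peak [simp]: "length (peak m) = 2 * m"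
  by (simp add: peak_def)

lemma height_peak: "i \<le> 2 * m \<Longrightarrow> height (peak m) i = min (int i) (2 * int m - int i)"
proof (cases "i \<le> m")
  case True
  then show ?thesis
    by (simp add: peak_def height_append_le height_replicate_U)
next
  case False
  assume "i \<le> 2 * m"
  with False show ?thesis
    using height_append_ge[of "replicate m U" "replicate m D" "i - m"]
    by (simp add: peak_def height_replicate_U height_replicate_D of_nat_diff)
qed

definition frame :: "nat \<Rightarrow> path \<Rightarrow> path" where
  "frame k z = replicate k U @ z @ replicate k D"

lemma length_frame [simp]: "length (frame k z) = 2 * k + length z"
  by (simp add: frame_def)

lemma frame_peak: "frame k (peak m) = peak (k + m)"
  unfolding frame_def peak_def
  by (simp add: replicate_add[of k m, symmetric] flip: append_assoc)
    (simp add: replicate_add[symmetric] add.commute)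

lemma height_frame:
  shows "i \<le> k \<Longrightarrow> height (frame k z) i = int i"
    and "j \<le> length z \<Longrightarrow> height (frame k z) (k + j) = int k + height z j"
    and "j \<le> k \<Longrightarrow> height (frame k z) (k + length z + j) = int k + height z (length z) - int j"
proof -
  show "i \<le> k \<Longrightarrow> height (frame k z) i = int i"
    by (simp add: frame_def height_append_le height_replicate_U)
  have *: "height (frame k z) (k + j) = int k + height (z @ replicate k D) j" for j
    using height_append_ge[of "replicate k U" "z @ replicate k D" j]
    by (simp add: frame_def height_replicate_U)
  show "j \<le> length z \<Longrightarrow> height (frame k z) (k + j) = int k + height z j"
    by (simp add: * height_append_le)
  show "j \<le> k \<Longrightarrow> height (frame k z) (k + length z + j) = int k + height z (length z) - int j"
    using height_append_ge[of z "replicate k D" j]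
    by (simp add: add.assoc * height_replicate_D)
qed

lemma frame_cases:
  fixes i k l :: nat
  assumes "i \<le> 2 * k + l"
  obtains "i \<le> k" | j where "i = k + j" "j \<le> l" | j where "i = k + l + j" "j \<le> k"
proof -
  have "i \<le> k \<or> k \<le> i \<and> i \<le> k + l \<or> k + l \<le> i" by linarith
  then consider "i \<le> k" | "k \<le> i" "i \<le> k + l" | "k + l \<le> i" by blast
  then show ?thesis
  proof cases
    case 1
    then show ?thesis using that(1) by blast
  next
    case 2
    then show ?thesis using that(2)[of "i - k"] by simp
  next
    case 3
    then show ?thesis using that(3)[of "i - (k + l)"] assms by simp
  qed
qed

lemma frame_le_frame_iff: "frame k p \<sqsubseteq> frame k q \<longleftrightarrow> p \<sqsubseteq> q"
proof
  assume le: "frame k p \<sqsubseteq> frame k q"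
  have len: "length p = length q"
    using length_path_le[OF le] by simp
  show "p \<sqsubseteq> q"
    unfolding path_le_def
  proof (intro conjI allI impI)
    fix i assume i: "i \<le> length p"
    then have "height (frame k p) (k + i) \<le> height (frame k q) (k + i)"
      using le by (simp add: path_le_def)
    then show "height p i \<le> height q i"
      using i len by (simp add: height_frame)
  qed (rule len)
next
  assume le: "p \<sqsubseteq> q"
  then have len: "length q = length p"
    by (rule length_path_le)
  show "frame k p \<sqsubseteq> frame k q"
    unfolding path_le_def
  proof (intro conjI allI impI)
    fix i assume "i \<le> length (frame k p)"
    then have "i \<le> 2 * k + length p" by simp
    then show "height (frame k p) i \<le> height (frame k q) i"
    proof (cases rule: frame_cases)
      case 1
      then show ?thesis by (simp add: height_frame)
    next
      case (2 j)
      then show ?thesis using le len by (simp add: height_frame path_le_def)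
    next
      case (3 j)
      then show ?thesis
        using le height_frame(3)[of j k p] height_frame(3)[of j k q] by (simp add: path_le_def)
    qed
  qed (simp add: len)
qed

text \<open>Both frames have equal heights over the first and the last \<open>k\<close> steps,
  because \<open>p\<close> and \<open>q\<close> end at the same height. This pins \<open>X\<close>
  down there and leaves only its middle part free.\<close>

lemma between_frames:
  assumes le: "frame k p \<sqsubseteq> X" "X \<sqsubseteq> frame k q"
    and len: "length p = l" "length q = l" and eq: "height p l = height q l"
  shows "X = frame k (take l (drop k X))"
proof (rule nth_equalityI)
  have lenX: "length X = 2 * k + l"
    using length_path_le[OF le(1)] len by simp
  then show "length X = length (frame k (take l (drop k X)))"
    by simp
  have sandwich: "height (frame k p) i = height (frame k q) i \<Longrightarrow> height X i = height (frame k p) i"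
    if "i \<le> 2 * k + l" for i
    using le[unfolded path_le_def, THEN conjunct2, rule_format, of i] that lenX len by simp
  have hU: "height X i = int i" if "i \<le> k" for i
    using sandwich[of i] that by (simp add: height_frame)
  have hD: "height X (k + l + j) = int k + height p l - int j" if "j \<le> k" for j
    using sandwich[of "k + l + j"] that height_frame(3)[of j k p] height_frame(3)[of j k q] len eq
    by simp
  fix i assume i: "i < length X"
  consider "i < k" | "k \<le> i" "i < k + l" | "k + l \<le> i"
    by (metis not_le)
  then show "X ! i = frame k (take l (drop k X)) ! i"
  proof cases
    case 1
    then have "rise (X ! i) = 1"
      using hU[of i] hU[of "Suc i"] by (simp add: height_Suc)
    then have "X ! i = U" by (cases "X ! i") auto
    then show ?thesis using 1 by (simp add: frame_def nth_append)
  next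
    case 2
    then have "i - k < l" by simp
    then show ?thesis using 2 lenX by (simp add: frame_def nth_append)
  next
    case 3
    then obtain j where j: "i = k + l + j" using le_Suc_ex by blast
    then have "rise (X ! i) = - 1"
      using hD[of j] hD[of "Suc j"] i lenX by (simp add: height_Suc)
    then have "X ! i = D" by (cases "X ! i") auto
    then show ?thesis using j i lenX by (simp add: frame_def nth_append)
  qed
qed

lemma take_drop_frame: "length z = l \<Longrightarrow> take l (drop k (frame k z)) = z"
  by (simp add: frame_def)

lemma path_le_top: "p \<sqsubseteq> top_path (length p)"
  using height_le by (simp add: path_le_def top_path_def height_replicate_U)

text \<open>The only property of products of pyramids that is needed: every point of the path lies on a
  straight run of steps starting or ending on the axis.\<close>

definition grounded :: "path \<Rightarrow> bool" where
  "grounded p \<longleftrightarrow> height p (length p) = 0 \<and>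
     (\<forall>i\<le>length p. \<exists>j\<le>length p. height p j = 0 \<and> height p i = \<bar>int i - int j\<bar>)"

lemma grounded_peak: "grounded (peak m)"
  unfolding grounded_def
proof (intro conjI allI impI)
  fix i assume i: "i \<le> length (peak m)"
  show "\<exists>j\<le>length (peak m). height (peak m) j = 0 \<and> height (peak m) i = \<bar>int i - int j\<bar>"
  proof (cases "i \<le> m")
    case True
    then show ?thesis using i by (intro exI[of _ 0]) (simp add: height_peak)
  next
    case False
    then show ?thesis using i by (intro exI[of _ "2 * m"]) (simp add: height_peak)
  qed
qed (simp add: height_peak)

lemma grounded_append:
  assumes p: "grounded p" and q: "grounded q"
  shows "grounded (p @ q)"
  unfolding grounded_def
proof (intro conjI allI impI)
  have p0: "height p (length p) = 0" using p by (simp add: grounded_def)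
  then show "height (p @ q) (length (p @ q)) = 0"
    using q height_append_ge[of p q "length q"] by (simp add: grounded_def)
  fix i assume i: "i \<le> length (p @ q)"
  show "\<exists>j\<le>length (p @ q). height (p @ q) j = 0 \<and> height (p @ q) i = \<bar>int i - int j\<bar>"
  proof (cases "i \<le> length p")
    case True
    with p obtain j where "j \<le> length p" "height p j = 0" "height p i = \<bar>int i - int j\<bar>"
      unfolding grounded_def by blast
    with True show ?thesis by (intro exI[of _ j]) (simp add: height_append_le)
  next
    case False
    then obtain i' where i': "i = length p + i'" by (metis le_Suc_ex nat_le_linear)
    with q i obtain j where "j \<le> length q" "height q j = 0" "height q i' = \<bar>int i' - int j\<bar>"
      unfolding grounded_def by auto
    then show ?thesis
      by (intro exI[of _ "length p + j"]) (simp add: i' height_append_ge p0)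
  qed
qed

lemma product_of_pyramids_grounded:
  assumes "product_of_pyramids a"
  shows "grounded a"
proof -
  obtain Ps where Ps: "\<forall>P\<in>set Ps. pyramid P" and a: "a = concat Ps"
    using assms by (auto simp: product_of_pyramids_def)
  from Ps have "grounded (concat Ps)"
  proof (induction Ps)
    case Nil
    then show ?case by (simp add: grounded_def)
  next
    case (Cons P Ps)
    then have "grounded P"
      by (auto simp: pyramid_def simp flip: peak_def intro: grounded_peak)
    with Cons show ?case by (simp add: grounded_append)
  qed
  then show ?thesis by (simp add: a)
qed

section \<open>Families of paths indexed by the integers\<close>

lemma mono_int_chain:
  assumes "\<And>t :: int. F t \<sqsubseteq> F (t + 1)" "s \<le> t"
  shows "F s \<sqsubseteq> F t"
  using assms(2)
proof (induction t rule: int_ge_induct)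
  case base
  then show ?case by simp
next
  case (step t)
  then show ?case using assms(1) path_le_trans by blast
qed

lemma antimono_int_chain:
  assumes "\<And>t :: int. F (t + 1) \<sqsubseteq> F t" "s \<le> t"
  shows "F t \<sqsubseteq> F s"
  using assms(2)
proof (induction t rule: int_ge_induct)
  case base
  then show ?case by simp
next
  case (step t)
  then show ?case using assms(1) path_le_trans by blast
qed

text \<open>The topmost cell of \<open>q\<close> in column \<open>i\<close> gives a bound weaker by
  one, and parity sharpens it.\<close>

lemma supports_height_le:
  assumes supp: "supports n (cells p) (cells q)" and len: "length p = n" "length q = n"
    and i: "i \<le> n" "i' \<le> n" "i' = Suc i \<or> i = Suc i'"
  shows "height q i \<le> height p i' + 1"
proof -
  have "(i, height q i - 2) \<in> cells q"
    using i len even_height[of q i] by (simp add: cells_def)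
  from supportsD[OF supp this i(2,3)] have "height q i - 3 < height p i'"
    by (simp add: cells_def)
  moreover have "even (height q i - height p i' - 1)"
    using even_height[of q i] even_height[of p i'] i(3) by auto
  ultimately show ?thesis by presburger
qed

section \<open>Small chains from a framed path\<close>

definition small_step :: "path \<Rightarrow> path \<Rightarrow> bool" where
  "small_step p q \<longleftrightarrow> p \<sqsubseteq> q \<and> small_interval p q"

lemma small_step_iff: "small_step p q \<longleftrightarrow> p \<sqsubseteq> q \<and> supports (length p) (cells p) (cells q)"
  using small_interval_iff_supports by (auto simp: small_step_def)

lemma small_step_refl: "small_step p p"
  by (simp add: small_step_iff supports_cells)

lemma small_chains_eq: "small_chains k p q = list_chains small_step k p q"
  by (simp add: small_chains_def list_chains_def small_step_def)

lemma length_top_path [simp]: "length (top_path n) = n"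
  by (simp add: top_path_def)

lemma height_top_path: "i \<le> n \<Longrightarrow> height (top_path n) i = int i"
  by (simp add: top_path_def height_replicate_U)

lemma eq_top_path_iff: "length p = n \<Longrightarrow> p = top_path n \<longleftrightarrow> height p n = int n"
proof
  assume len: "length p = n" and h: "height p n = int n"
  show "p = top_path n"
  proof (rule path_eqI)
    fix i assume "i \<le> length p"
    then show "height p i = height (top_path n) i"
      using height_le[of p i] height_le_height_add_dist[of p n i] h len
      by (simp add: height_top_path)
  qed (simp add: len)
qed (simp add: height_top_path)

text \<open>Here \<open>m\<close> is the half length of \<open>a\<close>. Positivity of
  \<open>n\<close> makes \<open>n - 1\<close> a genuine difference, so that it agrees with its
  integer counterpart.\<close>

locale framed_path =
  fixes a :: path and m k n :: nat
  assumes grounded: "grounded a" and length_a: "length a = 2 * m"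
    and n_eq: "n = 2 * (k + m)" and n_pos: "0 < n"
begin

definition P :: path where
  "P = frame k a"

lemma length_P: "length P = n"
  by (simp add: P_def length_a n_eq)

text \<open>In each case \<open>P\<close> is as high at \<open>i\<close> as slope one permits, given
  its height at 0, at \<open>n\<close>, or at a point \<open>j\<close> of height \<open>k\<close>.
  Another path therefore needs to be compared with \<open>P\<close> only at such points.\<close>

lemma height_P_cases:
  assumes "i \<le> n"
  obtains "height P i = int i"
  | "height P i = int n - int i"
  | j where "j \<le> n" "height P j = int k" "height P i = int k + \<bar>int i - int j\<bar>"
proof -
  from assms have "i \<le> 2 * k + 2 * m" by (simp add: n_eq)
  then show ?thesis
  proof (cases rule: frame_cases)
    case 1
    then show ?thesis using that(1) by (simp add: P_def height_frame)
  next
    case (2 i')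
    then obtain j where j: "j \<le> 2 * m" "height a j = 0" "height a i' = \<bar>int i' - int j\<bar>"
      using grounded length_a unfolding grounded_def by auto
    show ?thesis
      using 2 j that(3)[of "k + j"] by (simp add: P_def height_frame length_a n_eq)
  next
    case (3 j)
    then have "height P i = int k - int j"
      using height_frame(3)[of j k a] grounded by (simp add: P_def length_a grounded_def)
    then show ?thesis using 3 that(2) by (simp add: n_eq)
  qed
qed

lemma height_P_n: "height P n = 0"
proof -
  have "n = k + length a + k" by (simp add: n_eq length_a)
  then show ?thesis
    using height_frame(3)[of k k a] grounded by (simp add: P_def grounded_def)
qed

text \<open>Together with \<open>P_le_peak\<close> this says that below level \<open>k\<close> the
  path \<open>P\<close> has the same cells as the pyramid of length \<open>n\<close>.\<close>

lemma height_P_ge: "i \<le> n \<Longrightarrow> min (int i) (min (int k) (int n - int i)) \<le> height P i"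
  by (erule height_P_cases) auto

lemma height_peak_n: "i \<le> n \<Longrightarrow> height (peak (k + m)) i = min (int i) (int n - int i)"
  by (simp add: height_peak n_eq)

lemma P_le_peak: "P \<sqsubseteq> peak (k + m)"
  unfolding path_le_def
proof (intro conjI allI impI)
  fix i assume "i \<le> length P"
  then have i: "i \<le> n" by (simp add: length_P)
  then show "height P i \<le> height (peak (k + m)) i"
    using height_le[of P i] height_le_height_add_dist[of P i n] height_P_n
    by (simp add: height_peak_n)
qed (simp add: length_P n_eq)

section \<open>The two kinds of families exchanged by the shear\<close>

definition falling_families :: "(int \<Rightarrow> path) set" where
  "falling_families = {F. (\<forall>t\<le>0. F t = top_path n) \<and> (\<forall>t>int k. F t = P) \<and>
     (\<forall>t\<ge>1. F t \<sqsubseteq> peak (k + m)) \<and> (\<forall>t. F (t + 1) \<sqsubseteq> F t)}"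

lemma falling_families_supported:
  assumes "F \<in> falling_families"
  shows "F \<in> supported_families n"
proof -
  have len: "length (F t) = n" for t
  proof (cases "t \<le> 0")
    case True
    then show ?thesis using assms by (simp add: falling_families_def)
  next
    case False
    then have "F t \<sqsubseteq> peak (k + m)" using assms by (simp add: falling_families_def)
    from length_path_le[OF this] show ?thesis by (simp add: n_eq)
  qed
  have "F (t - 1 + 1) \<sqsubseteq> F (t - 1)" for t
    using assms unfolding falling_families_def by blast
  then have "cells (F t) \<subseteq> cells (F (t - 1))" for t
    by (simp add: path_le_iff_cells len)
  then have "supports n (cells (F (t - 1))) (cells (F t))" for t
    by (rule supports_mono[OF supports_cells[OF len]]) simp
  then show ?thesis
    by (simp add: supported_families_def len)
qed

abbreviation rising_families :: "(int \<Rightarrow> path) set" where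
  "rising_families \<equiv> int_chains small_step (n - 1) P (top_path n)"

lemma rising_families_mono:
  assumes "F \<in> rising_families" "s \<le> t"
  shows "F s \<sqsubseteq> F t"
  by (rule mono_int_chain) (use assms in \<open>auto simp: int_chains_def small_step_def\<close>)

lemma rising_families_ge:
  assumes "F \<in> rising_families"
  shows "P \<sqsubseteq> F t"
proof -
  have "F (min 0 t) = P" using assms by (simp add: int_chains_def)
  then show ?thesis using rising_families_mono[OF assms, of "min 0 t" t] by simp
qed

lemma rising_families_supported:
  assumes "F \<in> rising_families"
  shows "F \<in> supported_families n"
proof -
  have len: "length (F t) = n" for t
    using length_path_le[OF rising_families_ge[OF assms]] by (simp add: length_P)
  have "small_step (F (t - 1)) (F (t - 1 + 1))" for t
    using assms unfolding int_chains_def by blast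
  then show ?thesis
    by (simp add: supported_families_def len small_step_iff)
qed

lemma falling_families_ge:
  assumes "F \<in> falling_families"
  shows "P \<sqsubseteq> F t"
proof -
  have "F (max (int k + 1) t) = P" using assms by (simp add: falling_families_def)
  then show ?thesis
    using antimono_int_chain[of F t "max (int k + 1) t"] assms by (simp add: falling_families_def)
qed

text \<open>A lower bound that holds at all times survives any change of time.\<close>

lemma P_le_shear:
  assumes F: "F \<in> supported_families n" and ge: "\<And>t. P \<sqsubseteq> F t"
  shows "P \<sqsubseteq> shear n F t"
proof -
  have "length (F t) = n" for t using F by (simp add: supported_families_def)
  then have "cells P \<subseteq> cells (F t)" for t
    using ge by (simp add: path_le_iff_cells[symmetric] length_P)
  then have "cells P \<subseteq> cells (shear n F t)"
    unfolding subset_iff split_paired_All mem_cells_shear[OF F] by blast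
  then show ?thesis
    by (simp add: path_le_iff_cells length_P length_shear[OF F])
qed

lemma even_n: "even n"
  by (simp add: n_eq)

text \<open>Each boundary condition is decided by a single cell per column whose sheared time falls
  into a constant part of the chain; slope one then bounds the other columns.\<close>

lemma shear_rising:
  assumes C: "F \<in> rising_families"
  shows "shear n F \<in> falling_families"
proof -
  note F = rising_families_supported[OF C]
  let ?X = "shear n F"
  have low: "F t = P" if "t \<le> 0" for t
    using C that by (simp add: int_chains_def)
  have high: "F t = top_path n" if "t \<ge> int n - 1" for t
    using C that n_pos by (simp add: int_chains_def of_nat_diff)
  have lenX: "length (?X t) = n" for t
    by (rule length_shear[OF F])
  \<comment> \<open>A path of length \<open>n\<close> is the top path as soon as it ends at height
    \<open>n\<close>. The deciding cell \<open>(n, n - 2)\<close> has sheared time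
    \<open>n - 1 - t\<close>, where the chain has already reached the top.\<close>
  have top: "?X t = top_path n" if "t \<le> 0" for t
  proof -
    have "F (int n - 2 + 1 - t) = top_path n"
      using that by (intro high) simp
    then have "(n, int n - 2) \<in> cells (F (int n - 2 + 1 - t))"
      by (simp add: cells_def height_top_path)
    then have "(n, int n - 2) \<in> cells (?X t)"
      by (simp only: mem_cells_shear[OF F])
    then have "int n - 2 < height (?X t) n"
      by (simp add: cells_def)
    then have "height (?X t) n = int n"
      using even_height[of "?X t" n] height_le[of "?X t" n] by presburger
    then show ?thesis
      by (simp add: eq_top_path_iff lenX)
  qed
  \<comment> \<open>The cell \<open>(n, 0)\<close> has sheared time \<open>1 - t\<close>, at most 0,
    where the chain is still at \<open>P\<close>.\<close>
  have end0: "height (?X t) n \<le> 0" if "1 \<le> t" for t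
  proof -
    have "(n, 0) \<notin> cells (F (0 + 1 - t))"
      using low[of "0 + 1 - t"] that by (simp add: cells_def height_P_n)
    then have "(n, 0) \<notin> cells (?X t)"
      by (simp only: mem_cells_shear[OF F]) simp
    then show ?thesis
      by (simp add: mem_cells_iff[OF lenX] even_n)
  qed
  have peak: "?X t \<sqsubseteq> peak (k + m)" if "1 \<le> t" for t
    unfolding path_le_def
  proof (intro conjI allI impI)
    fix i assume "i \<le> length (?X t)"
    then have i: "i \<le> n" by (simp add: lenX)
    then show "height (?X t) i \<le> height (peak (k + m)) i"
      using height_le[of "?X t" i] height_le_height_add_dist[of "?X t" i n] end0[OF that]
      by (simp add: height_peak_n)
  qed (simp add: lenX, simp add: n_eq)
  have bot: "?X t = P" if t: "int k < t" for t
  proof (rule path_le_antisym)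
    show "P \<sqsubseteq> ?X t"
      using F rising_families_ge[OF C] by (rule P_le_shear)
    show "?X t \<sqsubseteq> P"
      unfolding path_le_def
    proof (intro conjI allI impI)
      fix i assume "i \<le> length (?X t)"
      then have i: "i \<le> n" by (simp add: lenX)
      then show "height (?X t) i \<le> height P i"
      proof (cases rule: height_P_cases)
        case 1
        then show ?thesis using height_le[of "?X t" i] by simp
      next
        case 2
        then show ?thesis
          using height_le_height_add_dist[of "?X t" i n] end0[of t] t i by simp
      next
        case (3 j)
        \<comment> \<open>Next the cell \<open>(j, k)\<close> is tested: its sheared time
          \<open>k + 1 - t\<close> is at most 0, and \<open>P\<close> has height \<open>k\<close> at
          \<open>j\<close>.\<close>
        have par: "even (int k - int j)"
          using even_height[of P j] 3 by simp
        have "(j, int k) \<notin> cells (F (int k + 1 - t))"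
          using low[of "int k + 1 - t"] t 3 by (simp add: cells_def)
        then have "(j, int k) \<notin> cells (?X t)"
          by (simp only: mem_cells_shear[OF F]) simp
        then have "height (?X t) j \<le> int k"
          using par 3 by (simp add: mem_cells_iff[OF lenX])
        then show ?thesis
          using height_le_height_add_dist[of "?X t" i j] 3 by simp
      qed
    qed (simp add: lenX length_P)
  qed
  have "?X (t + 1) \<sqsubseteq> ?X t" for t
    using rising_families_mono[OF C] by (intro shear_le_shear[OF F]) simp
  with top peak bot show ?thesis
    by (simp add: falling_families_def)
qed

lemma shear_falling:
  assumes D: "F \<in> falling_families"
  shows "shear n F \<in> rising_families"
proof -
  note F = falling_families_supported[OF D]
  let ?X = "shear n F"
  have low: "F t = top_path n" if "t \<le> 0" for t
    using D that by (simp add: falling_families_def)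
  have high: "F t = P" if "t > int k" for t
    using D that by (simp add: falling_families_def)
  have peak: "F t \<sqsubseteq> peak (k + m)" if "t \<ge> 1" for t
    using D that by (simp add: falling_families_def)
  have lenX: "length (?X t) = n" for t
    by (rule length_shear[OF F])
  have mono: "?X t \<sqsubseteq> ?X (t + 1)" for t
    using antimono_int_chain[of F] D
    by (intro shear_le_shear[OF F]) (simp add: falling_families_def)
  have "supports n (cells (?X (t + 1 - 1))) (cells (?X (t + 1)))" for t
    using shear_supported[OF F] unfolding supported_families_def by blast
  with mono have step: "small_step (?X t) (?X (t + 1))" for t
    by (simp add: small_step_iff lenX)
  have bot: "?X t = P" if t: "t \<le> 0" for t
  proof (rule path_le_antisym)
    show "P \<sqsubseteq> ?X t"
      using F falling_families_ge[OF D] by (rule P_le_shear)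
    have "(i, h) \<in> cells P" if "(i, h) \<in> cells (?X t)" for i h
    proof -
      let ?j = "h + 1 - t"
      have ih: "(i, h) \<in> cells (F ?j)"
        using that by (simp add: mem_cells_shear[OF F])
      have i: "i \<le> n" and par: "even (h - int i)"
        using that by (auto simp: cells_def lenX)
      have "h < height P i"
      proof -
        \<comment> \<open>For nonpositive \<open>?j\<close> the level \<open>h\<close> is negative,
          hence below \<open>P\<close>. For \<open>?j\<close> up to \<open>k\<close> the level is
          below \<open>k\<close>, where \<open>P\<close> and the pyramid have the same cells. Beyond
          that the family equals \<open>P\<close>.\<close>
        consider "?j \<le> 0" | "1 \<le> ?j" "?j \<le> int k" | "int k < ?j"
          by (metis int_one_le_iff_zero_less not_le)
        then show ?thesis
        proof cases
          case 1
          then show ?thesis using t height_P_ge[OF i] i by simp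
        next
          case 2
          have "height (F ?j) i \<le> height (peak (k + m)) i"
            using peak[OF 2(1)] i length_path_le[OF peak[OF 2(1)]]
            by (simp add: path_le_def n_eq)
          then have "h < min (int i) (int n - int i)"
            using ih i by (simp add: height_peak_n cells_def)
          then have "h < min (int i) (min (int k) (int n - int i))" using 2 t by simp
          then show ?thesis using height_P_ge[OF i] by (rule order_less_le_trans)
        next
          case 3
          then show ?thesis using ih high by (simp add: cells_def)
        qed
      qed
      with i par show ?thesis by (simp add: cells_def length_P)
    qed
    then show "?X t \<sqsubseteq> P"
      by (auto simp: path_le_iff_cells lenX length_P)
  qed
  \<comment> \<open>The chain length \<open>n - 1\<close> originates here: the sheared time
    \<open>n - 1 - t\<close> of the deciding cell \<open>(n, n - 2)\<close> is nonpositive exactly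
    from \<open>t = n - 1\<close> on.\<close>
  have "?X t = top_path n" if t: "t \<ge> int n - 1" for t
  proof -
    have "F (int n - 2 + 1 - t) = top_path n"
      using t by (intro low) simp
    then have "(n, int n - 2) \<in> cells (F (int n - 2 + 1 - t))"
      by (simp add: cells_def height_top_path)
    then have "(n, int n - 2) \<in> cells (?X t)"
      by (simp only: mem_cells_shear[OF F])
    then have "int n - 2 < height (?X t) n"
      by (simp add: cells_def)
    then have "height (?X t) n = int n"
      using even_height[of "?X t" n] height_le[of "?X t" n] by presburger
    then show ?thesis
      by (simp add: eq_top_path_iff lenX)
  qed
  with step bot show ?thesis
    using n_pos by (simp add: int_chains_def of_nat_diff)
qed

lemma card_rising_falling: "card rising_families = card falling_families"
  by (rule bij_betw_same_card[of "shear n"], rule bij_betw_byWitness[of _ "shear n"])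
    (auto simp: shear_shear rising_families_supported falling_families_supported
      shear_rising shear_falling simp del: One_nat_def)

lemma card_falling_families:
  "card falling_families = card (int_chains (\<sqsubseteq>) (k + 1) a (peak m))"
proof -
  \<comment> \<open>The index is reversed by \<open>k + 1 - t\<close>, so that rising becomes
    falling. The final \<open>peak m\<close> of \<open>G\<close> lands at index 0, where the top
    path overrides it; \<open>?g\<close> restores it.\<close>
  let ?f = "\<lambda>G t. if t \<le> 0 then top_path n else frame k (G (int k + 1 - t))"
  let ?g = "\<lambda>F t. if t \<ge> int k + 1 then peak m else take (2 * m) (drop k (F (int k + 1 - t)))"
  have len: "length (G t) = 2 * m" if "G \<in> int_chains (\<sqsubseteq>) (k + 1) a (peak m)" for G t
  proof -
    have "G (min 0 t) \<sqsubseteq> G t"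
      by (rule mono_int_chain) (use that in \<open>auto simp: int_chains_def\<close>)
    moreover have "G (min 0 t) = a"
      using that by (simp add: int_chains_def)
    ultimately show ?thesis
      using length_path_le length_a by metis
  qed
  have framed: "F t = frame k (take (2 * m) (drop k (F t)))" if "F \<in> falling_families" "1 \<le> t" for F t
  proof (rule between_frames)
    show "frame k a \<sqsubseteq> F t"
      using falling_families_ge[OF that(1)] by (simp add: P_def)
    show "F t \<sqsubseteq> frame k (peak m)"
      using that by (simp add: falling_families_def frame_peak)
    show "height a (2 * m) = height (peak m) (2 * m)"
      using grounded by (simp add: grounded_def length_a height_peak)
  qed (simp_all add: length_a)
  have "bij_betw ?f (int_chains (\<sqsubseteq>) (k + 1) a (peak m)) falling_families"
  proof (rule bij_betw_byWitness[where f' = ?g])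
    show "\<forall>G\<in>int_chains (\<sqsubseteq>) (k + 1) a (peak m). ?g (?f G) = G"
    proof
      fix G assume G: "G \<in> int_chains (\<sqsubseteq>) (k + 1) a (peak m)"
      then show "?g (?f G) = G"
        by (intro ext) (auto simp: take_drop_frame len[OF G] int_chains_def)
    qed
    show "\<forall>F\<in>falling_families. ?f (?g F) = F"
    proof
      fix F assume F: "F \<in> falling_families"
      show "?f (?g F) = F"
        using framed[OF F, symmetric] F by (intro ext) (auto simp: falling_families_def)
    qed
    show "?f ` int_chains (\<sqsubseteq>) (k + 1) a (peak m) \<subseteq> falling_families"
    proof clarify
      fix G assume G: "G \<in> int_chains (\<sqsubseteq>) (k + 1) a (peak m)"
      have mono: "G s \<sqsubseteq> G t" if "s \<le> t" for s t
        by (rule mono_int_chain) (use G that in \<open>auto simp: int_chains_def\<close>)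
      have bot: "G t = a" if "t \<le> 0" for t
        using G that by (simp add: int_chains_def)
      have top: "G (int k + 1) = peak m"
        using G by (simp add: int_chains_def)
      have le_top: "frame k (G t) \<sqsubseteq> top_path n" for t
        using path_le_top[of "frame k (G t)"] by (simp add: len[OF G] n_eq algebra_simps)
      have "frame k (G t) \<sqsubseteq> peak (k + m)" if "t \<le> int k + 1" for t
        using mono[OF that] by (simp add: top frame_le_frame_iff flip: frame_peak)
      with le_top show "?f G \<in> falling_families"
        by (auto simp: falling_families_def P_def bot frame_le_frame_iff intro: mono)
    qed
    show "?g ` falling_families \<subseteq> int_chains (\<sqsubseteq>) (k + 1) a (peak m)"
    proof clarify
      fix F assume F: "F \<in> falling_families"
      let ?z = "\<lambda>t. take (2 * m) (drop k (F t))"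
      have fz: "frame k (?z t) = F t" if "1 \<le> t" for t
        by (rule framed[OF F that, symmetric])
      have le_peak: "?z t \<sqsubseteq> peak m" if "1 \<le> t" for t
      proof -
        have "F t \<sqsubseteq> peak (k + m)" using F that by (simp add: falling_families_def)
        then have "frame k (?z t) \<sqsubseteq> frame k (peak m)"
          by (simp only: fz[OF that] frame_peak)
        then show ?thesis
          by (simp only: frame_le_frame_iff)
      qed
      have z_a: "?z t = a" if "int k < t" for t
      proof -
        have "F t = P" using F that by (simp add: falling_families_def)
        then show ?thesis by (simp add: P_def take_drop_frame length_a)
      qed
      have anti: "?z (int k + 1 - t) \<sqsubseteq> ?z (int k + 1 - (t + 1))" if "t + 1 \<le> int k" for t
      proof -
        have "F (int k + 1 - t) \<sqsubseteq> F (int k + 1 - (t + 1))"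
          by (rule antimono_int_chain) (use F in \<open>auto simp: falling_families_def\<close>)
        moreover have "1 \<le> int k + 1 - t" "1 \<le> int k + 1 - (t + 1)"
          using that by simp_all
        ultimately have "frame k (?z (int k + 1 - t)) \<sqsubseteq> frame k (?z (int k + 1 - (t + 1)))"
          by (simp only: fz)
        then show ?thesis
          by (simp only: frame_le_frame_iff)
      qed
      show "?g F \<in> int_chains (\<sqsubseteq>) (k + 1) a (peak m)"
        unfolding int_chains_def
      proof (intro CollectI conjI allI impI)
        fix t
        \<comment> \<open>For \<open>t = int k\<close> the chain moves from the core of
          \<open>F 1\<close> to the constant \<open>peak m\<close>, which is the case for
          \<open>le_peak\<close>.\<close>
        show "?g F t \<sqsubseteq> ?g F (t + 1)"
          using anti[of t] le_peak[of "int k + 1 - t"] by auto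
      qed (auto simp: z_a)
    qed
  qed
  then show ?thesis
    by (rule bij_betw_same_card[symmetric])
qed

section \<open>The degree of the framed path\<close>

text \<open>The last two abscissae support each other, so the height there grows by at most one per filling;
  this bounds the degree from below.\<close>

lemma height_filling_power_le:
  "i = n \<or> i = n - 1 \<Longrightarrow> height ((filling ^^ t) P) i \<le> int t + 1"
proof (induction t arbitrary: i)
  case 0
  then show ?case
    using height_P_n height_le_height_add_dist[of P i n] n_pos by (auto simp: of_nat_diff)
next
  case (Suc t)
  let ?Q = "(filling ^^ t) P"
  define i' where "i' = (if i = n then n - 1 else n)"
  have "supports n (cells ?Q) (cells (filling ?Q))"
    using supports_filling[of ?Q] by (simp add: length_P)
  then have "height (filling ?Q) i \<le> height ?Q i' + 1"
    by (rule supports_height_le) (use Suc.prems n_pos in \<open>auto simp: length_P i'_def\<close>)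
  moreover have "height ?Q i' \<le> int t + 1"
    by (rule Suc.IH) (simp add: i'_def)
  ultimately show ?case by simp
qed

text \<open>The witness is the pointwise least falling family. The small chain it yields bounds the
  degree of \<open>P\<close> from above.\<close>

lemma rising_families_nonempty: "rising_families \<noteq> {}"
proof -
  have "(\<lambda>t. if t \<le> 0 then top_path n else P) \<in> falling_families"
    using P_le_peak path_le_top[of P] by (auto simp: falling_families_def length_P)
  then show ?thesis
    using shear_falling by blast
qed

text \<open>Iterated filling stays above a small chain that reaches the top at time
  \<open>n - 1\<close>. Conversely, after \<open>t\<close> fillings the endpoint has height at most
  \<open>t + 1\<close>, while the top path ends at height \<open>n\<close>.\<close>

lemma degree_P: "degree P = n - 1"
  unfolding degree_def
proof (rule Least_equality)
  obtain F where F: "F \<in> rising_families"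
    using rising_families_nonempty by blast
  \<comment> \<open>Iterated filling dominates every small chain.\<close>
  have "F (int t) \<sqsubseteq> (filling ^^ t) P" for t
  proof (induction t)
    case 0
    have "F 0 = P" using F by (simp add: int_chains_def)
    then show ?case by simp
  next
    case (Suc t)
    let ?Q = "(filling ^^ t) P"
    have len: "length (F t) = n" for t
      using rising_families_supported[OF F] by (simp add: supported_families_def)
    have "small_step (F (int t)) (F (int t + 1))"
      using F unfolding int_chains_def by blast
    then have "supports n (cells (F (int t))) (cells (F (int t + 1)))"
      by (simp add: small_step_iff len)
    moreover have "cells (F (int t)) \<subseteq> cells ?Q"
      using Suc by (simp add: path_le_iff_cells len length_P)
    ultimately have "supports n (cells ?Q) (cells (F (int t + 1)))"
      by (rule supports_mono) simp
    then have "F (int t + 1) \<sqsubseteq> filling ?Q"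
      by (intro supports_imp_le_filling) (simp_all add: len length_P)
    then show ?case by (simp add: add.commute)
  qed
  from this[of "n - 1"] have "top_path n \<sqsubseteq> (filling ^^ (n - 1)) P"
    using F by (simp add: int_chains_def)
  then show "(filling ^^ (n - 1)) P = top_path (length P)"
    using path_le_top[of "(filling ^^ (n - 1)) P"] by (simp add: length_P path_le_antisym)
next
  fix t assume "(filling ^^ t) P = top_path (length P)"
  then have "int n \<le> int t + 1"
    using height_filling_power_le[of n t] by (simp add: length_P height_top_path)
  then show "n - 1 \<le> t" by simp
qed

lemma num_chains_P: "int (num_chains P) = conv_power zeta (k + 1) a (peak m)"
proof -
  have "num_chains P = card (list_chains small_step (n - 1) P (top_path n))"
    by (simp add: num_chains_def degree_P length_P small_chains_eq)
  also have "\<dots> = card rising_families"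
    by (simp add: card_int_chains small_step_refl)
  also have "\<dots> = card (int_chains (\<sqsubseteq>) (k + 1) a (peak m))"
    by (simp only: card_rising_falling card_falling_families)
  also have "\<dots> = card (list_chains (\<sqsubseteq>) (k + 1) a (peak m))"
    by (rule card_int_chains) simp
  finally show ?thesis
    by (simp only: conv_power_zeta)
qed

end

lemma grounded_even_length: "grounded p \<Longrightarrow> even (length p)"
  using even_height[of p "length p"] by (simp add: grounded_def)

theorem corollary16:
  fixes a :: path and k :: nat
  assumes "product_of_pyramids a"
  shows "int (num_chains (replicate k U @ a @ replicate k D)) =
    conv_power zeta (k + 1) a
      (replicate (length a div 2) U @ replicate (length a div 2) D)"
proof (cases "k = 0 \<and> a = []")
  \<comment> \<open>The empty path lies outside \<open>framed_path\<close>; here both sides equal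
    1.\<close>
  case True
  have "degree [] = 0"
    unfolding degree_def by (rule Least_equality) (simp_all add: top_path_def)
  then have "num_chains [] = 1"
    by (simp add: num_chains_def small_chains_eq list_chains_0 top_path_def)
  moreover have "conv_power zeta (0 + 1) [] [] = 1"
    by (simp add: convolution_def zeta_def path_le_def Collect_conv_if)
  ultimately show ?thesis using True by simp
next
  case False
  have "grounded a"
    using assms by (rule product_of_pyramids_grounded)
  moreover from this have len: "length a = 2 * (length a div 2)"
    by (simp add: grounded_even_length)
  ultimately interpret framed_path a "length a div 2" k "2 * (k + length a div 2)"
    using False by unfold_locales auto
  show ?thesis
    using num_chains_P by (simp add: P_def frame_def peak_def)
qed

end
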